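(* Let $n\in\mathbb{N}$ and let $\bm x=[X_1,\ldots,X_{2n}]^T\in\mathbb{R}^{2n}$ be a Gaussian random vector made of $2n$ independent Gaussian random variables $X_i\sim\mathcal{N}(0,\sigma_i^2)$. Let $\sigma^2=\sum_{i=1}^{2n}\sigma_i^2$ (with $\sigma=\sqrt{\sigma^2}$) and let $t\ge0$. Then $$\mathbb{P}\big(\|\bm x\|-\mathbb{E}\{\|\bm x\|\}>t\big)\le 1-2^{-2n}\bigg[1+\mathrm{erf}\bigg(\frac{t}{\sigma\sqrt2}\bigg)\bigg].$$
   Context: $\|\cdot\|$ is the Euclidean norm, and $\mathrm{erf}(x)=\frac{2}{\sqrt\pi}\int_0^xe^{-s^2}ds$ is the error function. *)

theory Defs
  imports "HOL-Probability.Probability"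
begin

text \<open>The interval integral is oriented, so this is the odd function \<open>erf\<close> on all of \<open>\<real>\<close>.\<close>

definition erf :: "real \<Rightarrow> real" where
  "erf x = 2 / sqrt pi * (LBINT s=ereal 0..ereal x. exp (- (s\<^sup>2)))"

text \<open>
  The Gaussian law with mean \<open>\<mu>\<close> and standard deviation \<open>s \<ge> 0\<close>, including the degenerate
  case \<open>s = 0\<close> (point mass at \<open>\<mu>\<close>), which a density with respect to \<open>lborel\<close> cannot express.
\<close>

definition gaussian_measure :: "real \<Rightarrow> real \<Rightarrow> real measure" where
  "gaussian_measure \<mu> s =
     (if s = 0 then return borel \<mu> else density lborel (\<lambda>y. ennreal (normal_density \<mu> s y)))"

lemma distr_eq_gaussian_measure_iff:
  assumes "X \<in> borel_measurable M" and "s > 0"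
  shows "distr M borel X = gaussian_measure \<mu> s \<longleftrightarrow> distributed M lborel X (normal_density \<mu> s)"
proof -
  have "distr M lborel X = distr M borel X"
    by (rule distr_cong) simp_all
  with assms show ?thesis
    by (simp add: gaussian_measure_def distributed_def)
qed

end

theory Submission
  imports Defs
begin

text \<open>
  With \<open>c = \<surd>(2/\<pi>) + t/\<sigma>\<close>, the box \<open>\<bar>X\<^sub>i\<bar> \<le> c \<sigma>\<^sub>i\<close> (all \<open>i\<close>) lies in the ball of radius
  \<open>c \<sigma> = \<surd>(2/\<pi>) \<sigma> + t\<close>. Pairing the vector of the \<open>\<bar>X\<^sub>i\<bar>\<close> with \<open>(\<sigma>\<^sub>i)\<close> in the Cauchy-Schwarz
  inequality and taking expectations gives \<open>\<surd>(2/\<pi>) \<sigma> \<le> E\<parallel>x\<parallel>\<close>, so on the box \<open>\<parallel>x\<parallel> \<le> E\<parallel>x\<parallel> + t\<close>.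
  By independence the box has probability at least \<open>e\<close> to the power \<open>2n\<close>, where
  \<open>e = erf (1/\<surd>\<pi> + t/(\<sigma>\<surd>2))\<close>. It remains to see that \<open>(2e)\<close> to the power \<open>2n\<close> is at least
  \<open>1 + erf (t/(\<sigma>\<surd>2))\<close>, and since this number is at least \<open>1\<close>, the case \<open>n = 1\<close> suffices.
\<close>

section \<open>The error function\<close>

lemma erf_has_field_derivative:
  "(erf has_field_derivative 2 / sqrt pi * exp (- (x\<^sup>2))) (at x)"
proof -
  define K where "K = \<bar>x\<bar> + 1"
  have "((\<lambda>u. LBINT y=ereal 0..ereal u. exp (- (y\<^sup>2))) has_vector_derivative exp (- (x\<^sup>2)))
          (at x within {-K..K})"
    by (rule interval_integral_FTC2) (auto simp: K_def intro!: continuous_intros)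
  moreover have "x \<in> interior {-K..K}"
    by (auto simp: K_def)
  ultimately have "((\<lambda>u. LBINT y=ereal 0..ereal u. exp (- (y\<^sup>2))) has_field_derivative exp (- (x\<^sup>2)))
      (at x)"
    by (metis at_within_interior has_real_derivative_iff_has_vector_derivative)
  from DERIV_cmult[OF this, of "2 / sqrt pi"] show ?thesis
    unfolding erf_def[abs_def] .
qed

lemma erf_0 [simp]: "erf 0 = 0"
  by (simp add: erf_def)

lemma erf_minus [simp]: "erf (- x) = - erf x"
proof -
  have "(LBINT s=ereal 0..ereal (-x). exp (- (s\<^sup>2))) = (LBINT s=ereal x..ereal 0. exp (- (s\<^sup>2)))"
    by (subst interval_integral_reflect) (simp add: zero_ereal_def)
  also have "\<dots> = - (LBINT s=ereal 0..ereal x. exp (- (s\<^sup>2)))"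
    by (rule interval_integral_endpoints_reverse)
  finally show ?thesis
    by (simp add: erf_def)
qed

lemma erf_mono: "x \<le> y \<Longrightarrow> erf x \<le> erf y"
  using erf_has_field_derivative by (intro DERIV_nonneg_imp_nondecreasing[of x y erf]) fastforce+

lemma erf_le_linear:
  assumes "x \<ge> 0"
  shows "erf x \<le> 2 / sqrt pi * x"
proof -
  have "2 / sqrt pi * 0 - erf 0 \<le> 2 / sqrt pi * x - erf x"
  proof (rule DERIV_nonneg_imp_nondecreasing[OF assms])
    fix u :: real
    have "((\<lambda>u. 2 / sqrt pi * u - erf u) has_field_derivative
            2 / sqrt pi * 1 - 2 / sqrt pi * exp (- (u\<^sup>2))) (at u)"
      by (rule derivative_eq_intros erf_has_field_derivative refl | simp)+
    moreover have "2 / sqrt pi * 1 - 2 / sqrt pi * exp (- (u\<^sup>2)) \<ge> 0"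
      unfolding right_diff_distrib[symmetric] by (intro mult_nonneg_nonneg) auto
    ultimately show "\<exists>y. ((\<lambda>u. 2 / sqrt pi * u - erf u) has_field_derivative y) (at u) \<and> y \<ge> 0"
      by blast
  qed
  then show ?thesis by simp
qed

text \<open>Integrates \<open>1 - u\<^sup>2 \<le> exp (- (u\<^sup>2))\<close> from 0 to
  \<open>x\<close>.\<close>

lemma erf_ge_cubic:
  assumes "x \<ge> 0"
  shows "erf x \<ge> 2 / sqrt pi * (x - x ^ 3 / 3)"
proof -
  have "erf 0 - 2 / sqrt pi * (0 - 0 ^ 3 / 3) \<le> erf x - 2 / sqrt pi * (x - x ^ 3 / 3)"
  proof (rule DERIV_nonneg_imp_nondecreasing[OF assms])
    fix u :: real
    have "((\<lambda>u. erf u - 2 / sqrt pi * (u - u ^ 3 / 3)) has_field_derivative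
            2 / sqrt pi * exp (- (u\<^sup>2)) - 2 / sqrt pi * (1 - u\<^sup>2)) (at u)"
      by (rule derivative_eq_intros erf_has_field_derivative refl | simp)+
    moreover have "2 / sqrt pi * exp (- (u\<^sup>2)) - 2 / sqrt pi * (1 - u\<^sup>2) \<ge> 0"
      unfolding right_diff_distrib[symmetric]
      using exp_ge_add_one_self[of "- (u\<^sup>2)"] by (intro mult_nonneg_nonneg) auto
    ultimately show "\<exists>y. ((\<lambda>u. erf u - 2 / sqrt pi * (u - u ^ 3 / 3)) has_field_derivative y) (at u) \<and> y \<ge> 0"
      by blast
  qed
  then show ?thesis by simp
qed

section \<open>The centred Gaussian law\<close>

text \<open>Rescaling by \<open>s * sqrt 2\<close> turns the density into half the derivative of
  \<open>erf\<close>, and oddness merges the two endpoint values. As \<open>c\<close> counts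
  standard deviations, \<open>s\<close> drops out.\<close>

lemma measure_gaussian_symmetric_Icc:
  assumes "s > 0" "c \<ge> 0"
  shows "measure (gaussian_measure 0 s) {- (c * s)..c * s} = erf (c / sqrt 2)"
proof -
  let ?F = "\<lambda>y. erf (y / (s * sqrt 2)) / 2"
  have F: "(?F has_field_derivative normal_density 0 s y) (at y)" for y
  proof -
    have "((\<lambda>y. y / (s * sqrt 2)) has_field_derivative 1 / (s * sqrt 2)) (at y)"
      by (rule derivative_eq_intros refl | use assms in simp)+
    from DERIV_cdivide[OF DERIV_chain2[OF erf_has_field_derivative this], of 2]
    have "(?F has_field_derivative
       2 / sqrt pi * exp (- ((y / (s * sqrt 2))\<^sup>2)) * (1 / (s * sqrt 2)) / 2) (at y)" .
    moreover have "2 / sqrt pi * exp (- ((y / (s * sqrt 2))\<^sup>2)) * (1 / (s * sqrt 2)) / 2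
        = normal_density 0 s y"
      using assms by (simp add: normal_density_def real_sqrt_mult power_divide power_mult_distrib field_simps)
    ultimately show ?thesis by simp
  qed
  have "emeasure (gaussian_measure 0 s) {- (c * s)..c * s}
      = (\<integral>\<^sup>+y. ennreal (normal_density 0 s y) * indicator {- (c * s)..c * s} y \<partial>lborel)"
    using assms by (simp add: gaussian_measure_def emeasure_density)
  also have "\<dots> = ennreal (?F (c * s) - ?F (- (c * s)))"
    by (rule nn_integral_FTC_Icc) (use F assms in \<open>auto intro: DERIV_subset\<close>)
  also have "?F (c * s) - ?F (- (c * s)) = erf (c / sqrt 2)"
    using assms by simp
  finally have "emeasure (gaussian_measure 0 s) {- (c * s)..c * s} = ennreal (erf (c / sqrt 2))" .
  moreover have "erf (c / sqrt 2) \<ge> 0"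
    using erf_mono[of 0 "c / sqrt 2"] assms by simp
  ultimately show ?thesis
    by (simp add: measure_def)
qed

lemma prob_space_gaussian_measure: "s \<ge> 0 \<Longrightarrow> prob_space (gaussian_measure \<mu> s)"
  by (auto simp: gaussian_measure_def intro: prob_space_return prob_space_normal_density)

text \<open>For \<open>x \<ge> 0\<close> the value is a standard normal probability, so no limit at
  infinity has to be computed.\<close>

lemma erf_le_1: "erf x \<le> 1"
proof (cases "x \<ge> 0")
  case True
  interpret prob_space "gaussian_measure 0 1"
    by (rule prob_space_gaussian_measure) simp
  have "measure (gaussian_measure 0 1) {- (x * sqrt 2 * 1)..x * sqrt 2 * 1} = erf (x * sqrt 2 / sqrt 2)"
    by (rule measure_gaussian_symmetric_Icc) (use True in auto)
  then show ?thesis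
    using prob_le_1 by (metis nonzero_mult_div_cancel_right real_sqrt_eq_zero_cancel_iff zero_neq_numeral)
next
  case False
  then show ?thesis
    using erf_mono[of x 0] by simp
qed

text \<open>For \<open>s = 0\<close> the interval shrinks to the atom at 0, of mass 1, so equality
  weakens to an inequality there.\<close>

lemma measure_gaussian_symmetric_Icc_ge:
  assumes "s \<ge> 0" "c \<ge> 0"
  shows "measure (gaussian_measure 0 s) {- (c * s)..c * s} \<ge> erf (c / sqrt 2)"
  using assms erf_le_1[of "c / sqrt 2"] measure_gaussian_symmetric_Icc[of s c]
  by (cases "s = 0") (auto simp: gaussian_measure_def measure_return)

lemma has_bochner_integral_abs_gaussian_measure:
  assumes "s \<ge> 0"
  shows "has_bochner_integral (gaussian_measure 0 s) (\<lambda>y. \<bar>y\<bar>) (sqrt (2 / pi) * s)"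
proof (cases "s = 0")
  case True
  interpret prob_space "return borel (0::real)"
    by (rule prob_space_return) simp
  have "AE y in return borel (0::real). \<bar>y\<bar> = 0"
    by (subst AE_return) auto
  then have "has_bochner_integral (return borel (0::real)) (\<lambda>y. \<bar>y\<bar>) 0"
    by (subst has_bochner_integral_cong_AE[where g = "\<lambda>_. 0"]) auto
  then show ?thesis
    by (simp add: True gaussian_measure_def)
next
  case False
  with assms have "s > 0" by simp
  \<comment> \<open>The absolute moment of order \<open>2 * k + 1\<close> about the mean, at mean 0
    and \<open>k = 0\<close>.\<close>
  from normal_moment_abs_odd[OF this, of 0 0]
  have "has_bochner_integral lborel (\<lambda>y. normal_density 0 s y *\<^sub>R \<bar>y\<bar>) (sqrt (2 / pi) * s)"
    by (simp add: mult.commute)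
  then have "has_bochner_integral (density lborel (normal_density 0 s)) (\<lambda>y. \<bar>y\<bar>) (sqrt (2 / pi) * s)"
    by (intro has_bochner_integral_density) auto
  then show ?thesis
    using False by (simp add: gaussian_measure_def)
qed

section \<open>The numerical inequality\<close>

lemma one_plus_erf_le:
  assumes "s \<ge> 0"
  shows "1 + erf s \<le> 4 * (erf (1 / sqrt pi + s))\<^sup>2"
proof -
  have pi_bounds: "3.14 < pi" "pi < 3.15"
    using pi_approx by auto
  have sqrt_bounds: "1.77 < sqrt pi" "sqrt pi < 1.775"
    using pi_bounds real_less_rsqrt[of "1.77" pi] real_less_lsqrt[of "1.775" pi]
    by (simp_all add: power2_eq_square)
  \<comment> \<open>For small \<open>s\<close> the value \<open>erf (1 / sqrt pi)\<close> already suffices; for larger \<open>s\<close> the left-hand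
    side is at most \<open>2\<close>, so that \<open>erf (1 / sqrt pi + s) \<ge> 1 / sqrt 2\<close> is enough.\<close>
  show ?thesis
  proof (cases "s \<le> 1 / 4")
    case True
    have "erf s \<le> 2 / sqrt pi * s"
      by (rule erf_le_linear[OF assms])
    also have "\<dots> \<le> 2 / 1.77 * (1 / 4)"
      using True assms sqrt_bounds by (intro mult_mono divide_left_mono) auto
    \<comment> \<open>0.567 fits between two estimates: \<open>4 * 0.567\<^sup>2\<close> is about
      1.286, above \<open>1 + 0.5 / 1.77\<close>, while the cubic bound at
      \<open>1 / sqrt pi\<close> gives about 0.5675.\<close>
    finally have "1 + erf s \<le> 4 * 0.567\<^sup>2"
      by (simp add: power2_eq_square)
    also have "0.567 \<le> erf (1 / sqrt pi + s)"
    proof -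
      have "0.567 \<le> 2 / pi * (1 - 1 / (3 * pi))"
      proof -
        have "0.567 \<le> 2 / 3.15 * (1 - 1 / (3 * 3.14) :: real)"
          by simp
        also have "\<dots> \<le> 2 / pi * (1 - 1 / (3 * pi))"
          using pi_bounds by (intro mult_mono divide_left_mono diff_left_mono) auto
        finally show ?thesis .
      qed
      also have "\<dots> = 2 / sqrt pi * (1 / sqrt pi - (1 / sqrt pi) ^ 3 / 3)"
        by (simp add: power3_eq_cube field_simps)
      also have "\<dots> \<le> erf (1 / sqrt pi)"
        by (rule erf_ge_cubic) simp
      also have "\<dots> \<le> erf (1 / sqrt pi + s)"
        by (rule erf_mono) (use assms in simp)
      finally show ?thesis .
    qed
    then have "4 * 0.567\<^sup>2 \<le> 4 * (erf (1 / sqrt pi + s))\<^sup>2"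
      by (intro mult_left_mono power_mono) auto
    finally show ?thesis .
  next
    case False
    \<comment> \<open>0.708 slightly exceeds \<open>1 / sqrt 2\<close>. The point 0.8 used below is
      0.55 + 1/4, where 0.55 bounds \<open>1 / sqrt pi\<close> from below; the cubic bound there
      gives about 0.709.\<close>
    have "1 + erf s \<le> 4 * 0.708\<^sup>2"
      using erf_le_1[of s] by (simp add: power2_eq_square)
    also have "0.708 \<le> erf (1 / sqrt pi + s)"
    proof -
      have "0.708 \<le> 2 / 1.775 * (0.8 - 0.8 ^ 3 / 3 :: real)"
        by (simp add: power3_eq_cube)
      also have "\<dots> \<le> 2 / sqrt pi * (0.8 - 0.8 ^ 3 / 3)"
        using sqrt_bounds by (intro mult_right_mono divide_left_mono) (auto simp: power3_eq_cube)
      also have "\<dots> \<le> erf 0.8"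
        by (rule erf_ge_cubic) simp
      also have "\<dots> \<le> erf (1 / sqrt pi + s)"
      proof (rule erf_mono)
        have "0.55 \<le> 1 / sqrt pi"
          using sqrt_bounds by (simp add: field_simps)
        with False show "0.8 \<le> 1 / sqrt pi + s" by simp
      qed
      finally show ?thesis .
    qed
    then have "4 * 0.708\<^sup>2 \<le> 4 * (erf (1 / sqrt pi + s))\<^sup>2"
      by (intro mult_left_mono power_mono) auto
    finally show ?thesis .
  qed
qed

section \<open>The tail bound for the norm\<close>

theorem lemma4:
  fixes M :: "'a measure" and x :: "'a \<Rightarrow> real ^ 'm" and sd :: "'m \<Rightarrow> real"
    and n :: nat and \<sigma> t :: real
  assumes "prob_space M"
    and "CARD('m) = 2 * n"
    and "\<And>i. sd i \<ge> 0"
    and "\<And>i. distr M borel (\<lambda>\<omega>. x \<omega> $ i) = gaussian_measure 0 (sd i)"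
    and "prob_space.indep_vars M (\<lambda>_. borel) (\<lambda>i \<omega>. x \<omega> $ i) UNIV"
    and "\<sigma> = sqrt (\<Sum>i\<in>UNIV. (sd i)\<^sup>2)"
    and "\<sigma> > 0"
    and "t \<ge> 0"
  shows "measure M {\<omega> \<in> space M. norm (x \<omega>) - prob_space.expectation M (\<lambda>\<omega>. norm (x \<omega>)) > t}
           \<le> 1 - (1 / 2 ^ (2 * n)) * (1 + erf (t / (\<sigma> * sqrt 2)))"
proof -
  interpret prob_space M by fact
  have X_measurable [measurable]: "(\<lambda>\<omega>. x \<omega> $ i) \<in> borel_measurable M" for i
    using assms(5) by (simp add: indep_vars_def)
  have norm_eq: "norm (x \<omega>) = sqrt (\<Sum>i\<in>UNIV. (x \<omega> $ i)\<^sup>2)" for \<omega>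
    by (simp add: norm_vec_def L2_set_def)
  have norm_measurable [measurable]: "(\<lambda>\<omega>. norm (x \<omega>)) \<in> borel_measurable M"
    unfolding norm_eq by measurable
  have sigma2: "(\<Sum>i\<in>UNIV. (sd i)\<^sup>2) = \<sigma>\<^sup>2"
    unfolding assms(6) by (simp add: sum_nonneg)

  have abs_integral: "has_bochner_integral M (\<lambda>\<omega>. \<bar>x \<omega> $ i\<bar>) (sqrt (2 / pi) * sd i)" for i
  proof -
    have "has_bochner_integral (distr M borel (\<lambda>\<omega>. x \<omega> $ i)) (\<lambda>y. \<bar>y\<bar>) (sqrt (2 / pi) * sd i)"
      using has_bochner_integral_abs_gaussian_measure[OF assms(3)] by (simp add: assms(4))
    then show ?thesis
      by (simp add: has_bochner_integral_iff integral_distr integrable_distr_eq)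
  qed
  have norm_integrable: "integrable M (\<lambda>\<omega>. norm (x \<omega>))"
  proof (rule Bochner_Integration.integrable_bound)
    show "integrable M (\<lambda>\<omega>. \<Sum>i\<in>UNIV. \<bar>x \<omega> $ i\<bar>)"
      using abs_integral by (auto simp: has_bochner_integral_iff)
    show "AE \<omega> in M. norm (norm (x \<omega>)) \<le> norm (\<Sum>i\<in>UNIV. \<bar>x \<omega> $ i\<bar>)"
      using norm_le_l1_cart by (intro AE_I2) (auto intro: order_trans[OF _ abs_ge_self])
  qed measurable

  have mean_ge: "sqrt (2 / pi) * \<sigma> \<le> expectation (\<lambda>\<omega>. norm (x \<omega>))"
  proof -
    \<comment> \<open>The weights \<open>sd i\<close> make the Cauchy-Schwarz bound
      \<open>\<sigma> * norm (x \<omega>)\<close>; one factor \<open>\<sigma>\<close> cancels at the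
      end.\<close>
    have "has_bochner_integral M (\<lambda>\<omega>. \<Sum>i\<in>UNIV. sd i * \<bar>x \<omega> $ i\<bar>)
            (\<Sum>i\<in>UNIV. sd i * (sqrt (2 / pi) * sd i))"
      by (intro has_bochner_integral_sum has_bochner_integral_mult_right abs_integral)
    moreover have "(\<Sum>i\<in>UNIV. sd i * (sqrt (2 / pi) * sd i)) = sqrt (2 / pi) * \<sigma>\<^sup>2"
      unfolding sigma2[symmetric] by (simp add: sum_distrib_left power2_eq_square mult_ac)
    ultimately have I: "has_bochner_integral M (\<lambda>\<omega>. \<Sum>i\<in>UNIV. sd i * \<bar>x \<omega> $ i\<bar>) (sqrt (2 / pi) * \<sigma>\<^sup>2)"
      by simp
    have "(\<Sum>i\<in>UNIV. sd i * \<bar>x \<omega> $ i\<bar>) \<le> \<sigma> * norm (x \<omega>)" for \<omega>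
      using L2_set_mult_ineq[of sd "\<lambda>i. x \<omega> $ i" UNIV] assms(3,6)
      by (simp add: L2_set_def norm_eq)
    then have "sqrt (2 / pi) * \<sigma>\<^sup>2 \<le> expectation (\<lambda>\<omega>. \<sigma> * norm (x \<omega>))"
      using I norm_integrable by (subst has_bochner_integral_integral_eq[OF I, symmetric])
        (intro integral_mono, auto simp: has_bochner_integral_iff)
    also have "\<dots> = \<sigma> * expectation (\<lambda>\<omega>. norm (x \<omega>))"
      by simp
    finally show ?thesis
      using \<open>\<sigma> > 0\<close> by (simp add: power2_eq_square)
  qed

  \<comment> \<open>\<open>s\<close> is the argument of \<open>erf\<close> in the claim, and
    \<open>c / sqrt 2\<close> is the argument of \<open>erf\<close> in \<open>e\<close>, the lower
    bound for each coordinate's probability.\<close>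
  define s where "s = t / (\<sigma> * sqrt 2)"
  define c where "c = sqrt 2 * (1 / sqrt pi + s)"
  define e where "e = erf (1 / sqrt pi + s)"
  have "s \<ge> 0"
    using assms by (simp add: s_def)
  then have "c \<ge> 0" "e \<ge> 0"
    using erf_mono[of 0 "1 / sqrt pi + s"] by (auto simp: c_def e_def)
  have c_sigma: "c * \<sigma> = sqrt (2 / pi) * \<sigma> + t"
    using \<open>\<sigma> > 0\<close> by (simp add: c_def s_def real_sqrt_divide field_simps)

  \<comment> \<open>A finite intersection of preimages, the form in which independence gives a
    product of probabilities.\<close>
  let ?box = "\<Inter>i\<in>UNIV. (\<lambda>\<omega>. x \<omega> $ i) -` {- (c * sd i)..c * sd i} \<inter> space M"
  have "?box \<subseteq> {\<omega> \<in> space M. norm (x \<omega>) \<le> expectation (\<lambda>\<omega>. norm (x \<omega>)) + t}"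
  proof (intro subsetI CollectI conjI)
    fix \<omega> assume \<omega>: "\<omega> \<in> ?box"
    then show "\<omega> \<in> space M" by auto
    have "\<bar>x \<omega> $ i\<bar> \<le> \<bar>c * sd i\<bar>" for i
    proof -
      have "x \<omega> $ i \<in> {- (c * sd i)..c * sd i}"
        using \<omega> by blast
      then show ?thesis by auto
    qed
    then have "(\<Sum>i\<in>UNIV. (x \<omega> $ i)\<^sup>2) \<le> (\<Sum>i\<in>UNIV. (c * sd i)\<^sup>2)"
      by (intro sum_mono) (simp add: abs_le_square_iff)
    also have "\<dots> = (c * \<sigma>)\<^sup>2"
      by (simp add: power_mult_distrib sum_distrib_left[symmetric] sigma2)
    finally have "norm (x \<omega>) \<le> c * \<sigma>"
      unfolding norm_eq using \<open>c \<ge> 0\<close> \<open>\<sigma> > 0\<close> by (intro real_le_lsqrt) (auto simp: sum_nonneg)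
    then show "norm (x \<omega>) \<le> expectation (\<lambda>\<omega>. norm (x \<omega>)) + t"
      using mean_ge c_sigma by simp
  qed
  then have "prob ?box \<le> prob {\<omega> \<in> space M. norm (x \<omega>) \<le> expectation (\<lambda>\<omega>. norm (x \<omega>)) + t}"
    by (intro finite_measure_mono) measurable
  also have "\<dots> = 1 - prob {\<omega> \<in> space M. norm (x \<omega>) - expectation (\<lambda>\<omega>. norm (x \<omega>)) > t}"
    by (subst prob_compl[symmetric]) (auto intro!: arg_cong[where f = prob])
  finally have tail: "prob {\<omega> \<in> space M. norm (x \<omega>) - expectation (\<lambda>\<omega>. norm (x \<omega>)) > t} \<le> 1 - prob ?box"
    by simp

  have "e ^ (2 * n) = (\<Prod>i\<in>(UNIV :: 'm set). e)"
    by (simp add: assms(2))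
  also have "\<dots> \<le> (\<Prod>i\<in>UNIV. prob ((\<lambda>\<omega>. x \<omega> $ i) -` {- (c * sd i)..c * sd i} \<inter> space M))"
  proof (intro prod_mono conjI \<open>e \<ge> 0\<close>)
    fix i
    have "e \<le> measure (gaussian_measure 0 (sd i)) {- (c * sd i)..c * sd i}"
      using measure_gaussian_symmetric_Icc_ge[OF assms(3) \<open>c \<ge> 0\<close>, of i] by (simp add: c_def e_def)
    then show "e \<le> prob ((\<lambda>\<omega>. x \<omega> $ i) -` {- (c * sd i)..c * sd i} \<inter> space M)"
      by (simp add: assms(4)[symmetric] measure_distr)
  qed
  also have "\<dots> = prob ?box"
    using assms(5) by (intro indep_varsD_finite[symmetric]) auto
  finally have box: "e ^ (2 * n) \<le> prob ?box" .

  \<comment> \<open>The index type is nonempty, which rules out dimension 0.\<close>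
  have "n > 0"
    using assms(2) zero_less_card_finite[where 'a = 'm] by simp
  have "1 + erf s \<le> (4 * e\<^sup>2) ^ 1"
    using one_plus_erf_le[OF \<open>s \<ge> 0\<close>] by (simp add: e_def)
  \<comment> \<open>Raising to the power \<open>n\<close> does not decrease the base, since
    \<open>4 * e\<^sup>2 \<ge> 1 + erf s \<ge> 1\<close>.\<close>
  also have "\<dots> \<le> (4 * e\<^sup>2) ^ n"
    using \<open>n > 0\<close> \<open>s \<ge> 0\<close> calculation erf_mono[of 0 s] by (intro power_increasing) auto
  also have "\<dots> = 2 ^ (2 * n) * e ^ (2 * n)"
    by (simp add: power_mult power_mult_distrib)
  finally have "1 / 2 ^ (2 * n) * (1 + erf s) \<le> e ^ (2 * n)"
    by (simp add: field_simps)
  with tail box show ?thesis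
    unfolding s_def by linarith
qed

end
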